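(* Let $d\ge 2$ and $n\ge 1$. Let $Z_d(n)$ be the number of equivalence classes of $d$-tuples $(\sigma_1,\dots,\sigma_d)\in (S_n)^{\times d}$ under $(\sigma_1,\dots,\sigma_d)\sim(\gamma_1\sigma_1\gamma_2,\dots,\gamma_1\sigma_d\gamma_2)$, $\gamma_1,\gamma_2\in S_n$. Let $G_d$ be the graph with two vertices and $d$ edges each joining these two vertices, and let $F_{d-1}$ be the graph with one vertex and $d-1$ loop edges. Then $$Z_d(n)=Z[G_d\times S^1;S_n]=Z[F_{d-1}\times S^1;S_n],$$ where $Z[X;S_n]$ is the permutation lattice gauge theory partition function; explicitly, $$Z_d(n)=\frac{1}{(n!)^2}\sum_{\gamma_1,\gamma_2\in S_n}\ \sum_{\sigma_1,\dots,\sigma_d\in S_n}\ \prod_{a=1}^d\delta(\gamma_1\sigma_a\gamma_2\sigma_a^{-1})=\frac1{n!}\sum_{\gamma\in S_n}\ \sum_{\tau_1,\dots,\tau_{d-1}\in S_n}\ \prod_{a=1}^{d-1}\delta(\gamma\tau_a\gamma^{-1}\tau_a^{-1}).$$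
   Context: $S_n$ is the symmetric group on $\{1,\dots,n\}$; $\delta$ is the function on $S_n$ equal to $1$ at the identity and $0$ elsewhere. For a finite group $G$ and a finite 2-dimensional cell complex $X$ with $V$ vertices, $Z[X;G]=\frac{1}{|G|^{V}}\sum_{(g_e)}\prod_{P}\delta\big(\prod_{e\in P}g_e\big)$, where the sum is over assignments of a group element $g_e\in G$ to each (oriented) edge $e$ (with $g_{e^{-1}}=g_e^{-1}$), the product is over all 2-cells $P$, and $\prod_{e\in P}g_e$ is the ordered product around the boundary of $P$. For a graph $\Gamma$, $\Gamma\times S^1$ is given the product cell structure in which $S^1$ has one vertex and one edge: it has one vertex per vertex of $\Gamma$, one edge per edge of $\Gamma$, one additional loop edge per vertex of $\Gamma$ (the circle direction), and one 2-cell per edge of $\Gamma$. *)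

theory Defs
  imports Complex_Main "HOL-Library.FuncSet" "HOL-Algebra.Sym_Groups" "Graph_Theory.Digraph"
begin

section \<open>Finite 2-dimensional cell complexes\<close>

text \<open>
  An (unoriented) edge of a graph or of a 1-skeleton is represented by a single arc of a
  \<^type>\<open>pre_digraph\<close>, i.e. with an arbitrary reference orientation; loops and
  parallel edges are allowed. An oriented edge is a pair \<open>(e, b)\<close>: the arc \<open>e\<close>
  traversed along (\<open>b = True\<close>) or against (\<open>b = False\<close>) its reference
  orientation. A 2-cell is attached along a closed path of oriented edges.
\<close>

record ('v, 'e, 'f) cell_complex =
  skel :: "('v, 'e) pre_digraph"
  faces :: "'f set"
  bdry :: "'f \<Rightarrow> ('e \<times> bool) list"

definition src :: "('v, 'e) pre_digraph \<Rightarrow> 'e \<times> bool \<Rightarrow> 'v" where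
  "src G x = (if snd x then tail G (fst x) else head G (fst x))"

definition dst :: "('v, 'e) pre_digraph \<Rightarrow> 'e \<times> bool \<Rightarrow> 'v" where
  "dst G x = (if snd x then head G (fst x) else tail G (fst x))"

definition closed_path :: "('v, 'e) pre_digraph \<Rightarrow> ('e \<times> bool) list \<Rightarrow> bool" where
  "closed_path G p \<longleftrightarrow> fst ` set p \<subseteq> arcs G \<and>
     (\<forall>i < length p. dst G (p ! i) = src G (p ! (Suc i mod length p)))"

definition finite_cell_complex :: "('v, 'e, 'f) cell_complex \<Rightarrow> bool" where
  "finite_cell_complex X \<longleftrightarrow>
     fin_digraph (skel X) \<and> finite (faces X) \<and> (\<forall>P \<in> faces X. closed_path (skel X) (bdry X P))"

text \<open>
  The product cell structure on the product of two graphs: an edge \<open>e\<close> of \<open>\<Gamma>\<close> and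
  an edge \<open>f\<close> of \<open>\<Delta>\<close> span a square, whose boundary runs through
  \<open>e \<times> tail f\<close>, \<open>head e \<times> f\<close>, and then backwards through
  \<open>e \<times> head f\<close>, \<open>tail e \<times> f\<close>.
\<close>

definition graph_prod ::
  "('v, 'e) pre_digraph \<Rightarrow> ('w, 'f) pre_digraph
    \<Rightarrow> ('v \<times> 'w, ('e \<times> 'w) + ('v \<times> 'f), 'e \<times> 'f) cell_complex" where
  "graph_prod \<Gamma> \<Delta> =
     \<lparr> skel =
         \<lparr> verts = verts \<Gamma> \<times> verts \<Delta>,
           arcs = (arcs \<Gamma> \<times> verts \<Delta>) <+> (verts \<Gamma> \<times> arcs \<Delta>),
           tail = case_sum (\<lambda>(e, w). (tail \<Gamma> e, w)) (\<lambda>(v, f). (v, tail \<Delta> f)),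
           head = case_sum (\<lambda>(e, w). (head \<Gamma> e, w)) (\<lambda>(v, f). (v, head \<Delta> f)) \<rparr>,
       faces = arcs \<Gamma> \<times> arcs \<Delta>,
       bdry = (\<lambda>(e, f). [(Inl (e, tail \<Delta> f), True), (Inr (head \<Gamma> e, f), True),
                         (Inl (e, head \<Delta> f), False), (Inr (tail \<Gamma> e, f), False)]) \<rparr>"

definition circle :: "(unit, unit) pre_digraph" where
  "circle = \<lparr> verts = {()}, arcs = {()}, tail = (\<lambda>_. ()), head = (\<lambda>_. ()) \<rparr>"

definition times_circle ::
  "('v, 'e) pre_digraph
    \<Rightarrow> ('v \<times> unit, ('e \<times> unit) + ('v \<times> unit), 'e \<times> unit) cell_complex" where
  "times_circle \<Gamma> = graph_prod \<Gamma> circle"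

definition G_graph :: "nat \<Rightarrow> (nat, nat) pre_digraph" where
  "G_graph d = \<lparr> verts = {1, 2}, arcs = {1..d}, tail = (\<lambda>_. 1), head = (\<lambda>_. 2) \<rparr>"

definition F_graph :: "nat \<Rightarrow> (unit, nat) pre_digraph" where
  "F_graph k = \<lparr> verts = {()}, arcs = {1..k}, tail = (\<lambda>_. ()), head = (\<lambda>_. ()) \<rparr>"

lemma closed_path_4:
  "closed_path G [x, y, z, w] \<longleftrightarrow> fst ` {x, y, z, w} \<subseteq> arcs G \<and>
     dst G x = src G y \<and> dst G y = src G z \<and> dst G z = src G w \<and> dst G w = src G x"
  by (auto simp: closed_path_def All_less_Suc)

lemma finite_cell_complex_graph_prod:
  assumes "fin_digraph \<Gamma>" and "fin_digraph \<Delta>"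
  shows "finite_cell_complex (graph_prod \<Gamma> \<Delta>)"
proof -
  interpret g: fin_digraph \<Gamma> by fact
  interpret h: fin_digraph \<Delta> by fact
  have "fin_digraph (skel (graph_prod \<Gamma> \<Delta>))"
    by unfold_locales (auto simp: graph_prod_def)
  moreover have "closed_path (skel (graph_prod \<Gamma> \<Delta>)) (bdry (graph_prod \<Gamma> \<Delta>) P)"
    if "P \<in> faces (graph_prod \<Gamma> \<Delta>)" for P
    using that by (auto simp: graph_prod_def closed_path_4 src_def dst_def)
  ultimately show ?thesis
    by (simp add: finite_cell_complex_def) (simp add: graph_prod_def)
qed

lemma fin_digraph_circle: "fin_digraph circle"
  by unfold_locales (auto simp: circle_def)

lemma fin_digraph_G_graph: "fin_digraph (G_graph d)"
  by unfold_locales (auto simp: G_graph_def)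

lemma fin_digraph_F_graph: "fin_digraph (F_graph k)"
  by unfold_locales (auto simp: F_graph_def)


section \<open>The lattice gauge theory partition function\<close>

definition delta :: "('a, 'b) monoid_scheme \<Rightarrow> 'a \<Rightarrow> real" where
  "delta G x = (if x = \<one>\<^bsub>G\<^esub> then 1 else 0)"

definition holonomy ::
  "('a, 'b) monoid_scheme \<Rightarrow> ('e \<Rightarrow> 'a) \<Rightarrow> ('e \<times> bool) list \<Rightarrow> 'a" where
  "holonomy G g p =
     foldr (\<otimes>\<^bsub>G\<^esub>) (map (\<lambda>(e, b). if b then g e else inv\<^bsub>G\<^esub> (g e)) p) \<one>\<^bsub>G\<^esub>"

definition partition_function ::
  "('v, 'e, 'f) cell_complex \<Rightarrow> ('a, 'b) monoid_scheme \<Rightarrow> real" where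
  "partition_function X G =
     1 / real (order G) ^ card (verts (skel X)) *
     (\<Sum>g \<in> arcs (skel X) \<rightarrow>\<^sub>E carrier G. \<Prod>P \<in> faces X. delta G (holonomy G g (bdry X P)))"


section \<open>Equivalence classes of tuples of permutations\<close>

definition perm_tuples :: "nat \<Rightarrow> nat \<Rightarrow> (nat \<Rightarrow> nat \<Rightarrow> nat) set" where
  "perm_tuples d n = {1..d} \<rightarrow>\<^sub>E carrier (sym_group n)"

definition tuple_rel :: "nat \<Rightarrow> nat \<Rightarrow> (nat \<Rightarrow> nat \<Rightarrow> nat) rel" where
  "tuple_rel d n =
     {(\<sigma>, \<sigma>'). \<sigma> \<in> perm_tuples d n \<and> \<sigma>' \<in> perm_tuples d n \<and>
       (\<exists>\<gamma>\<^sub>1 \<in> carrier (sym_group n). \<exists>\<gamma>\<^sub>2 \<in> carrier (sym_group n).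
          \<forall>a \<in> {1..d}. \<sigma>' a = \<gamma>\<^sub>1 \<otimes>\<^bsub>sym_group n\<^esub> \<sigma> a \<otimes>\<^bsub>sym_group n\<^esub> \<gamma>\<^sub>2)}"

definition num_tuple_classes :: "nat \<Rightarrow> nat \<Rightarrow> nat" where
  "num_tuple_classes d n = card (perm_tuples d n // tuple_rel d n)"

lemma equiv_tuple_rel: "equiv (perm_tuples d n) (tuple_rel d n)"
proof -
  interpret group "sym_group n" by (rule sym_group_is_group)
  have mem: "\<sigma> a \<in> carrier (sym_group n)" if "\<sigma> \<in> perm_tuples d n" "a \<in> {1..d}" for \<sigma> a
    using that by (auto simp: perm_tuples_def)
  show ?thesis
  proof (rule equivI)
    show "tuple_rel d n \<subseteq> perm_tuples d n \<times> perm_tuples d n"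
      by (auto simp: tuple_rel_def)
    show "refl_on (perm_tuples d n) (tuple_rel d n)"
      using mem by (auto simp: refl_on_def tuple_rel_def intro!: bexI[of _ "\<one>\<^bsub>sym_group n\<^esub>"])
    have solve: "s = inv\<^bsub>sym_group n\<^esub> x \<otimes>\<^bsub>sym_group n\<^esub> (x \<otimes>\<^bsub>sym_group n\<^esub> s \<otimes>\<^bsub>sym_group n\<^esub> y) \<otimes>\<^bsub>sym_group n\<^esub> inv\<^bsub>sym_group n\<^esub> y"
      if "x \<in> carrier (sym_group n)" "y \<in> carrier (sym_group n)" "s \<in> carrier (sym_group n)" for x y s
    proof -
      have "inv\<^bsub>sym_group n\<^esub> x \<otimes>\<^bsub>sym_group n\<^esub> (x \<otimes>\<^bsub>sym_group n\<^esub> s) = s"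
        using that by (simp add: m_assoc[symmetric] del: sym_group_inv_equality)
      then show ?thesis
        using that by (simp add: m_assoc del: sym_group_inv_equality)
    qed
    show "sym (tuple_rel d n)"
    proof (rule symI)
      fix \<sigma> \<rho> assume *: "(\<sigma>, \<rho>) \<in> tuple_rel d n"
      then obtain x y where xy: "x \<in> carrier (sym_group n)" "y \<in> carrier (sym_group n)"
        "\<forall>a \<in> {1..d}. \<rho> a = x \<otimes>\<^bsub>sym_group n\<^esub> \<sigma> a \<otimes>\<^bsub>sym_group n\<^esub> y"
        by (auto simp: tuple_rel_def)
      have "\<sigma> \<in> perm_tuples d n" using * by (simp add: tuple_rel_def)
      then have "\<forall>a \<in> {1..d}. \<sigma> a =
          inv\<^bsub>sym_group n\<^esub> x \<otimes>\<^bsub>sym_group n\<^esub> \<rho> a \<otimes>\<^bsub>sym_group n\<^esub> inv\<^bsub>sym_group n\<^esub> y"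
        using xy mem solve by (simp del: sym_group_inv_equality)
      then show "(\<rho>, \<sigma>) \<in> tuple_rel d n"
        using * xy(1,2) inv_closed unfolding tuple_rel_def by blast
    qed
    show "trans (tuple_rel d n)"
    proof (rule transI)
      fix \<sigma> \<rho> \<tau> assume *: "(\<sigma>, \<rho>) \<in> tuple_rel d n" "(\<rho>, \<tau>) \<in> tuple_rel d n"
      then obtain x y x' y' where xy: "x \<in> carrier (sym_group n)" "y \<in> carrier (sym_group n)"
        "x' \<in> carrier (sym_group n)" "y' \<in> carrier (sym_group n)"
        "\<forall>a \<in> {1..d}. \<rho> a = x \<otimes>\<^bsub>sym_group n\<^esub> \<sigma> a \<otimes>\<^bsub>sym_group n\<^esub> y"
        "\<forall>a \<in> {1..d}. \<tau> a = x' \<otimes>\<^bsub>sym_group n\<^esub> \<rho> a \<otimes>\<^bsub>sym_group n\<^esub> y'"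
        unfolding tuple_rel_def by blast
      have "\<sigma> \<in> perm_tuples d n" using * by (simp add: tuple_rel_def)
      then have "\<forall>a \<in> {1..d}. \<tau> a = (x' \<otimes>\<^bsub>sym_group n\<^esub> x) \<otimes>\<^bsub>sym_group n\<^esub> \<sigma> a
          \<otimes>\<^bsub>sym_group n\<^esub> (y \<otimes>\<^bsub>sym_group n\<^esub> y')"
        using xy mem by (simp add: m_assoc)
      then show "(\<sigma>, \<tau>) \<in> tuple_rel d n"
        using * xy(1-4) m_closed unfolding tuple_rel_def by blast
    qed
  qed
qed

end

theory Submission
  imports Defs "HOL-Algebra.Group_Action"
begin

text \<open>
  By Burnside's lemma for the action \<open>(\<gamma>\<^sub>1, \<gamma>\<^sub>2) \<cdot> \<sigma> = \<gamma>\<^sub>1 \<sigma> \<gamma>\<^sub>2\<inverse>\<close> of \<open>S\<^sub>n \<times> S\<^sub>n\<close>, the number of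
  classes is the double sum over \<open>\<gamma>\<^sub>1, \<gamma>\<^sub>2\<close>. The substitution \<open>\<tau>\<^sub>a = \<sigma>\<^sub>a \<sigma>\<^sub>d\<inverse>\<close> solves the constraint of
  \<open>\<sigma>\<^sub>d\<close> for \<open>\<gamma>\<^sub>2 = \<sigma>\<^sub>d\<inverse> \<gamma>\<^sub>1\<inverse> \<sigma>\<^sub>d\<close> and leaves a free sum over \<open>\<sigma>\<^sub>d\<close>, which cancels one factor \<open>n!\<close>.
  In the partition functions the variables on the circle edges play the role of the \<open>\<gamma>\<close>'s.
\<close>

section \<open>Sums over functions on one or two points\<close>

text \<open>Serves for the vertex set of \<open>F_graph\<close>, where the circle variables amount
  to a single group element; the analogue for a doubleton serves for \<open>G_graph\<close>.\<close>

lemma sum_PiE_singleton: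
  "(\<Sum>h\<in>{v} \<rightarrow>\<^sub>E C. F (h v)) = (\<Sum>x\<in>C. F x)"
  by (rule sum.reindex_bij_witness[where i = "\<lambda>x. \<lambda>_\<in>{v}. x" and j = "\<lambda>h. h v"])
    (auto simp: fun_eq_iff PiE_iff extensional_def)

lemma sum_PiE_doubleton:
  assumes "u \<noteq> v"
  shows "(\<Sum>h\<in>{u, v} \<rightarrow>\<^sub>E C. F (h u) (h v)) = (\<Sum>x\<in>C. \<Sum>y\<in>C. F x y)"
  unfolding sum.cartesian_product
  by (rule sum.reindex_bij_witness[where i = "\<lambda>(x, y). \<lambda>w\<in>{u, v}. if w = u then x else y"
        and j = "\<lambda>h. (h u, h v)"])
    (use assms in \<open>auto simp: fun_eq_iff PiE_iff extensional_def\<close>)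

section \<open>Two-sided multiplication as a group action\<close>

text \<open>The inverse on the right factor makes this a left action of the direct product, since
  inversion reverses products. The outer restriction makes each map extensional, as membership in
  \<open>Bij\<close> demands; the inner one keeps the resulting tuple extensional on
  \<open>I\<close>.\<close>

definition two_sided_action ::
  "('a, 'b) monoid_scheme \<Rightarrow> 'i set \<Rightarrow> 'a \<times> 'a \<Rightarrow> ('i \<Rightarrow> 'a) \<Rightarrow> 'i \<Rightarrow> 'a" where
  "two_sided_action G I =
     (\<lambda>(x, y). \<lambda>\<sigma> \<in> I \<rightarrow>\<^sub>E carrier G. \<lambda>a \<in> I. x \<otimes>\<^bsub>G\<^esub> \<sigma> a \<otimes>\<^bsub>G\<^esub> inv\<^bsub>G\<^esub> y)"

context group
begin

lemma two_sided_action_closed: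
  assumes "p \<in> carrier G \<times> carrier G" and "\<sigma> \<in> I \<rightarrow>\<^sub>E carrier G"
  shows "two_sided_action G I p \<sigma> \<in> I \<rightarrow>\<^sub>E carrier G"
  using assms by (auto simp: two_sided_action_def PiE_def Pi_def extensional_def)

lemma two_sided_action_mult:
  assumes "p \<in> carrier G \<times> carrier G" and "q \<in> carrier G \<times> carrier G"
    and "\<sigma> \<in> I \<rightarrow>\<^sub>E carrier G"
  shows "two_sided_action G I p (two_sided_action G I q \<sigma>) =
    two_sided_action G I (p \<otimes>\<^bsub>G \<times>\<times> G\<^esub> q) \<sigma>"
proof -
  have "two_sided_action G I p (two_sided_action G I q \<sigma>) a =
      two_sided_action G I (p \<otimes>\<^bsub>G \<times>\<times> G\<^esub> q) \<sigma> a" for a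
  proof (cases "a \<in> I")
    case True
    then have "\<sigma> a \<in> carrier G"
      using assms(3) by auto
    with True assms two_sided_action_closed[OF assms(2,3)] show ?thesis
      by (auto simp: two_sided_action_def m_assoc inv_mult_group)
  next
    case False
    with assms two_sided_action_closed[OF assms(2,3)] show ?thesis
      by (auto simp: two_sided_action_def)
  qed
  then show ?thesis by blast
qed

lemma two_sided_action_one:
  assumes "\<sigma> \<in> I \<rightarrow>\<^sub>E carrier G"
  shows "two_sided_action G I (\<one>, \<one>) \<sigma> = \<sigma>"
proof
  fix a
  show "two_sided_action G I (\<one>, \<one>) \<sigma> a = \<sigma> a"
    using assms by (cases "a \<in> I") (auto simp: two_sided_action_def PiE_iff extensional_def)
qed

text \<open>The componentwise inverse pair acts as the inverse map, by the multiplication and unit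
  laws of the action.\<close>

lemma two_sided_action_in_Bij:
  assumes "p \<in> carrier G \<times> carrier G"
  shows "two_sided_action G I p \<in> Bij (I \<rightarrow>\<^sub>E carrier G)"
proof -
  obtain x y where p: "p = (x, y)" "x \<in> carrier G" "y \<in> carrier G"
    using assms by auto
  define q where "q = (inv x, inv y)"
  have q: "q \<in> carrier G \<times> carrier G"
    and inverse: "p \<otimes>\<^bsub>G \<times>\<times> G\<^esub> q = (\<one>, \<one>)" "q \<otimes>\<^bsub>G \<times>\<times> G\<^esub> p = (\<one>, \<one>)"
    using p by (auto simp: q_def)
  have "bij_betw (two_sided_action G I p) (I \<rightarrow>\<^sub>E carrier G) (I \<rightarrow>\<^sub>E carrier G)"
    by (rule bij_betw_byWitness[where f' = "two_sided_action G I q"])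
      (simp_all add: assms q inverse two_sided_action_closed two_sided_action_mult
        two_sided_action_one image_subset_iff)
  moreover have "two_sided_action G I p \<in> extensional (I \<rightarrow>\<^sub>E carrier G)"
    using p by (simp add: two_sided_action_def)
  ultimately show ?thesis by (simp add: Bij_def)
qed

lemma group_action_two_sided:
  "group_action (G \<times>\<times> G) (I \<rightarrow>\<^sub>E carrier G) (two_sided_action G I)"
proof -
  have compose: "two_sided_action G I (p \<otimes>\<^bsub>G \<times>\<times> G\<^esub> q) =
      compose (I \<rightarrow>\<^sub>E carrier G) (two_sided_action G I p) (two_sided_action G I q)"
    if pq: "p \<in> carrier G \<times> carrier G" "q \<in> carrier G \<times> carrier G" for p q
  proof
    fix \<sigma>
    show "two_sided_action G I (p \<otimes>\<^bsub>G \<times>\<times> G\<^esub> q) \<sigma> =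
        compose (I \<rightarrow>\<^sub>E carrier G) (two_sided_action G I p) (two_sided_action G I q) \<sigma>"
    proof (cases "\<sigma> \<in> I \<rightarrow>\<^sub>E carrier G")
      case True
      then show ?thesis
        using two_sided_action_mult[OF pq True] by (simp add: compose_def)
    next
      \<comment> \<open>Off the set of tuples both sides are \<open>undefined\<close>, because
        \<open>compose\<close> and the action are restricted to the same set.\<close>
      case False
      then show ?thesis
        by (simp add: compose_def two_sided_action_def split_beta)
    qed
  qed
  have "two_sided_action G I \<in> hom (G \<times>\<times> G) (BijGroup (I \<rightarrow>\<^sub>E carrier G))"
    by (rule homI) (simp_all add: BijGroup_def two_sided_action_in_Bij compose del: mult_DirProd)
  then show ?thesis
    by (intro group_action.intro group_hom.intro group_hom_axioms.intro
        group_BijGroup DirProd_group is_group)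
qed

section \<open>Counting orbits by Burnside's lemma\<close>

lemma prod_delta:
  "finite I \<Longrightarrow> (\<Prod>a\<in>I. delta G (f a)) = (if \<forall>a\<in>I. f a = \<one> then 1 else 0)"
  by (auto simp: delta_def prod_zero_iff)

text \<open>A product of deltas is the indicator of a solution set. This turns the sums into
  cardinalities, to be matched with fixed points or compared by bijections.\<close>

lemma sum_prod_delta:
  assumes "finite A" and "finite I"
  shows "(\<Sum>x\<in>A. \<Prod>a\<in>I. delta G (f x a)) = real (card {x \<in> A. \<forall>a\<in>I. f x a = \<one>})"
  using assms by (simp add: prod_delta sum.If_cases Int_def)

lemma two_sided_action_fixpoint_iff:
  assumes "x \<in> carrier G" "y \<in> carrier G" "\<sigma> \<in> I \<rightarrow>\<^sub>E carrier G"
  shows "two_sided_action G I (x, y) \<sigma> = \<sigma> \<longleftrightarrow>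
    (\<forall>a\<in>I. x \<otimes> \<sigma> a \<otimes> inv y \<otimes> inv (\<sigma> a) = \<one>)"
proof -
  have mem: "\<sigma> a \<in> carrier G" if "a \<in> I" for a
    using that assms by auto
  \<comment> \<open>Both functions are \<open>undefined\<close> outside \<open>I\<close>, so their
    equality is a condition on the indices in \<open>I\<close> alone.\<close>
  have "two_sided_action G I (x, y) \<sigma> = \<sigma> \<longleftrightarrow> (\<forall>a\<in>I. x \<otimes> \<sigma> a \<otimes> inv y = \<sigma> a)"
    using assms by (auto simp: two_sided_action_def fun_eq_iff PiE_arb[OF assms(3)])
  also have "\<dots> \<longleftrightarrow> (\<forall>a\<in>I. x \<otimes> \<sigma> a \<otimes> inv y \<otimes> inv (\<sigma> a) = \<one>)"
    using assms mem
    by (metis inv_closed inv_equality inv_inv m_closed r_inv)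
  finally show ?thesis .
qed

text \<open>By Burnside, the number of orbits times the squared group order is the total number of
  fixed points, and each fixed-point count is a sum of products of deltas.\<close>

lemma card_orbits_two_sided:
  assumes "finite (carrier G)" and "finite I"
  shows "real (card (orbits (G \<times>\<times> G) (I \<rightarrow>\<^sub>E carrier G) (two_sided_action G I))) =
    1 / (real (order G))\<^sup>2 * (\<Sum>x\<in>carrier G. \<Sum>y\<in>carrier G. \<Sum>\<sigma>\<in>I \<rightarrow>\<^sub>E carrier G.
      \<Prod>a\<in>I. delta G (x \<otimes> \<sigma> a \<otimes> y \<otimes> inv (\<sigma> a)))" (is "?Z = _ * ?S")
proof -
  let ?T = "I \<rightarrow>\<^sub>E carrier G" and ?act = "two_sided_action G I"
  have finT: "finite ?T"
    using assms by (simp add: finite_PiE)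
  have pos: "order G > 0"
    using assms(1) order_gt_0_iff_finite by blast
  have ordGG: "order (G \<times>\<times> G) = (order G)\<^sup>2"
    by (simp add: order_def card_cartesian_product power2_eq_square)
  have "?Z * real (order (G \<times>\<times> G)) =
      (\<Sum>p\<in>carrier G \<times> carrier G. real (card (invariants ?T ?act p)))"
    using group_action.burnside[OF group_action_two_sided[of I]] assms(1) finT
    by (simp flip: of_nat_mult of_nat_sum)
  also have "\<dots> = (\<Sum>(x, y)\<in>carrier G \<times> carrier G.
      \<Sum>\<sigma>\<in>?T. \<Prod>a\<in>I. delta G (x \<otimes> \<sigma> a \<otimes> inv y \<otimes> inv (\<sigma> a)))"
  proof (rule sum.cong[OF refl], clarify)
    fix x y assume "x \<in> carrier G" "y \<in> carrier G"
    then have "invariants ?T ?act (x, y) =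
        {\<sigma> \<in> ?T. \<forall>a\<in>I. x \<otimes> \<sigma> a \<otimes> inv y \<otimes> inv (\<sigma> a) = \<one>}"
      by (auto simp: invariants_def two_sided_action_fixpoint_iff)
    then show "real (card (invariants ?T ?act (x, y))) =
        (\<Sum>\<sigma>\<in>?T. \<Prod>a\<in>I. delta G (x \<otimes> \<sigma> a \<otimes> inv y \<otimes> inv (\<sigma> a)))"
      using finT assms(2) by (simp add: sum_prod_delta)
  qed
  also have "\<dots> = (\<Sum>x\<in>carrier G. \<Sum>y\<in>carrier G.
      \<Sum>\<sigma>\<in>?T. \<Prod>a\<in>I. delta G (x \<otimes> \<sigma> a \<otimes> inv y \<otimes> inv (\<sigma> a)))"
    by (rule sum.cartesian_product[symmetric])
  also have "\<dots> = ?S"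
    \<comment> \<open>Substituting \<open>inv y\<close> for \<open>y\<close> removes the inverse
      that the left action had introduced.\<close>
    by (intro sum.cong[OF refl] sum.reindex_bij_witness[where i = "m_inv G" and j = "m_inv G"]) auto
  finally show ?thesis
    using pos ordGG by (simp add: field_simps)
qed

section \<open>Gauge fixing of the last permutation\<close>

text \<open>Both sides count solutions: \<open>?A\<close> is in bijection with
  \<open>?C \<times> ?B\<close>, where the factor \<open>?C\<close> records the unconstrained value
  \<open>\<sigma> (Suc k)\<close> and yields the factor \<open>order G\<close>.\<close>

lemma sum_gauge_fixed:
  assumes "finite (carrier G)"
  shows "(\<Sum>x\<in>carrier G. \<Sum>y\<in>carrier G. \<Sum>\<sigma>\<in>{1..Suc k} \<rightarrow>\<^sub>E carrier G.
      \<Prod>a = 1..Suc k. delta G (x \<otimes> \<sigma> a \<otimes> y \<otimes> inv (\<sigma> a))) =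
    real (order G) * (\<Sum>x\<in>carrier G. \<Sum>\<tau>\<in>{1..k} \<rightarrow>\<^sub>E carrier G.
      \<Prod>a = 1..k. delta G (x \<otimes> \<tau> a \<otimes> inv x \<otimes> inv (\<tau> a)))"
proof -
  let ?C = "carrier G" and ?\<Sigma> = "{1..Suc k} \<rightarrow>\<^sub>E carrier G" and ?T = "{1..k} \<rightarrow>\<^sub>E carrier G"
  let ?A = "{(x, y, \<sigma>) \<in> ?C \<times> ?C \<times> ?\<Sigma>. \<forall>a\<in>{1..Suc k}. x \<otimes> \<sigma> a \<otimes> y \<otimes> inv (\<sigma> a) = \<one>}"
  let ?B = "{(x, \<tau>) \<in> ?C \<times> ?T. \<forall>a\<in>{1..k}. x \<otimes> \<tau> a \<otimes> inv x \<otimes> inv (\<tau> a) = \<one>}"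
  have fin: "finite ?\<Sigma>" "finite ?T"
    using assms by (simp_all add: finite_PiE)
  have cancel: "u \<otimes> inv s \<otimes> s = u" "u \<otimes> s \<otimes> inv s = u" if "u \<in> ?C" "s \<in> ?C" for u s
    using that by (simp_all add: m_assoc)
  \<comment> \<open>Here \<open>t\<close> stands for \<open>\<sigma> (Suc k)\<close> and the bracket
    for the value of \<open>y\<close> that it forces. The constraint on \<open>s\<close> becomes the
    statement that \<open>x\<close> commutes with \<open>s \<otimes> inv t\<close>.\<close>
  have conj: "x \<otimes> s \<otimes> (inv t \<otimes> inv x \<otimes> t) \<otimes> inv s = x \<otimes> (s \<otimes> inv t) \<otimes> inv x \<otimes> inv (s \<otimes> inv t)"
    if "x \<in> ?C" "s \<in> ?C" "t \<in> ?C" for x s t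
    using that by (simp add: m_assoc inv_mult_group)
  have solve: "y = inv s \<otimes> inv x \<otimes> s"
    if "x \<in> ?C" "y \<in> ?C" "s \<in> ?C" "x \<otimes> s \<otimes> y \<otimes> inv s = \<one>" for x y s
  proof -
    have "(x \<otimes> s) \<otimes> y = s"
      using that by (metis inv_closed inv_equality inv_inv m_closed)
    then have "y = inv (x \<otimes> s) \<otimes> s"
      using that by (metis inv_solve_left m_closed)
    with that show ?thesis by (simp add: inv_mult_group)
  qed
  \<comment> \<open>The instance \<open>t = s\<close> of \<open>conj\<close>: with this choice of
    \<open>y\<close> the constraint at the last index holds for every \<open>x\<close> and
    \<open>s\<close>.\<close>
  have solved: "x \<otimes> s \<otimes> (inv s \<otimes> inv x \<otimes> s) \<otimes> inv s = \<one>" if "x \<in> ?C" "s \<in> ?C" for x s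
    using that by (simp add: conj)
  define j :: "'a \<times> 'a \<times> (nat \<Rightarrow> 'a) \<Rightarrow> 'a \<times> 'a \<times> (nat \<Rightarrow> 'a)"
    where "j = (\<lambda>(x, y, \<sigma>). (\<sigma> (Suc k), x, \<lambda>a\<in>{1..k}. \<sigma> a \<otimes> inv (\<sigma> (Suc k))))"
  define i where "i = (\<lambda>(s, x, \<tau>). (x, inv s \<otimes> inv x \<otimes> s,
      \<lambda>a\<in>{1..Suc k}. if a = Suc k then s else \<tau> a \<otimes> s))"
  have "bij_betw j ?A (?C \<times> ?B)"
  proof (rule bij_betw_byWitness[where f' = i])
    show "\<forall>p\<in>?A. i (j p) = p"
    proof clarify
      fix x y \<sigma>
      assume *: "x \<in> ?C" "y \<in> ?C" "\<sigma> \<in> ?\<Sigma>"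
        "\<forall>a\<in>{1..Suc k}. x \<otimes> \<sigma> a \<otimes> y \<otimes> inv (\<sigma> a) = \<one>"
      then have mem: "\<sigma> a \<in> ?C" if "a \<in> {1..Suc k}" for a
        using that by auto
      have "y = inv (\<sigma> (Suc k)) \<otimes> inv x \<otimes> \<sigma> (Suc k)"
        using * mem by (intro solve) auto
      moreover have "(\<lambda>a\<in>{1..Suc k}. if a = Suc k then \<sigma> (Suc k)
          else (\<lambda>a\<in>{1..k}. \<sigma> a \<otimes> inv (\<sigma> (Suc k))) a \<otimes> \<sigma> (Suc k)) = \<sigma>"
      proof
        fix a
        show "(\<lambda>a\<in>{1..Suc k}. if a = Suc k then \<sigma> (Suc k)
          else (\<lambda>a\<in>{1..k}. \<sigma> a \<otimes> inv (\<sigma> (Suc k))) a \<otimes> \<sigma> (Suc k)) a = \<sigma> a"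
          using mem[of a] mem[of "Suc k"] *(3)
          by (auto simp: cancel PiE_arb[OF *(3)])
      qed
      ultimately show "i (j (x, y, \<sigma>)) = (x, y, \<sigma>)"
        by (simp add: i_def j_def del: One_nat_def)
    qed
    show "\<forall>p\<in>?C \<times> ?B. j (i p) = p"
    proof clarify
      fix s x \<tau>
      assume *: "s \<in> ?C" "x \<in> ?C" "\<tau> \<in> ?T"
      have "(\<lambda>a\<in>{1..k}. \<tau> a \<otimes> s \<otimes> inv s) = \<tau>"
      proof
        fix a
        show "(\<lambda>a\<in>{1..k}. \<tau> a \<otimes> s \<otimes> inv s) a = \<tau> a"
          using * PiE_mem[OF *(3), of a] by (auto simp: cancel PiE_arb[OF *(3)])
      qed
      moreover have "(\<lambda>a\<in>{1..k}. (\<lambda>a\<in>{1..Suc k}. if a = Suc k then s else \<tau> a \<otimes> s) a \<otimes> inv s) =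
          (\<lambda>a\<in>{1..k}. \<tau> a \<otimes> s \<otimes> inv s)"
        by (rule restrict_ext) auto
      ultimately show "j (i (s, x, \<tau>)) = (s, x, \<tau>)"
        by (simp add: i_def j_def del: One_nat_def)
    qed
    show "j ` ?A \<subseteq> ?C \<times> ?B"
    proof clarify
      fix s x \<tau> x' y \<sigma>
      assume *: "x' \<in> ?C" "y \<in> ?C" "\<sigma> \<in> ?\<Sigma>"
        "\<forall>a\<in>{1..Suc k}. x' \<otimes> \<sigma> a \<otimes> y \<otimes> inv (\<sigma> a) = \<one>"
        and eq: "(s, x, \<tau>) = j (x', y, \<sigma>)"
      then have mem: "\<sigma> a \<in> ?C" if "a \<in> {1..Suc k}" for a
        using that by auto
      have y: "y = inv (\<sigma> (Suc k)) \<otimes> inv x' \<otimes> \<sigma> (Suc k)"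
        using * mem by (intro solve) auto
      have "x' \<otimes> (\<sigma> a \<otimes> inv (\<sigma> (Suc k))) \<otimes> inv x' \<otimes> inv (\<sigma> a \<otimes> inv (\<sigma> (Suc k))) = \<one>"
        if "a \<in> {1..k}" for a
        using that * y mem conj[of x' "\<sigma> a" "\<sigma> (Suc k)"] by auto
      then show "s \<in> ?C \<and> (x, \<tau>) \<in> ?B"
        using eq * mem by (auto simp: j_def)
    qed
    show "i ` (?C \<times> ?B) \<subseteq> ?A"
    proof clarify
      fix s x \<tau> x' y \<sigma>
      assume *: "s \<in> ?C" "x \<in> ?C" "\<tau> \<in> ?T"
        "\<forall>a\<in>{1..k}. x \<otimes> \<tau> a \<otimes> inv x \<otimes> inv (\<tau> a) = \<one>"
        and eq: "(x', y, \<sigma>) = i (s, x, \<tau>)"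
      then have mem: "\<tau> a \<in> ?C" if "a \<in> {1..k}" for a
        using that by auto
      have "x \<otimes> (\<tau> a \<otimes> s) \<otimes> (inv s \<otimes> inv x \<otimes> s) \<otimes> inv (\<tau> a \<otimes> s) = \<one>" if "a \<in> {1..k}" for a
        using that * mem[OF that] by (simp add: conj cancel)
      \<comment> \<open>The indices up to \<open>k\<close> are covered by the preceding fact, the
        index \<open>Suc k\<close> by \<open>solved\<close>.\<close>
      then show "(x', y, \<sigma>) \<in> ?C \<times> ?C \<times> ?\<Sigma> \<and>
          (\<forall>a\<in>{1..Suc k}. x' \<otimes> \<sigma> a \<otimes> y \<otimes> inv (\<sigma> a) = \<one>)"
        using eq * mem by (auto simp: i_def solved)
    qed
  qed
  then have card: "card ?A = order G * card ?B"
    by (simp add: bij_betw_same_card card_cartesian_product order_def)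
  \<comment> \<open>Iterated sums are packed into one sum over tuples, the form in which
    \<open>sum_prod_delta\<close> yields a cardinality.\<close>
  have "(\<Sum>x\<in>?C. \<Sum>y\<in>?C. \<Sum>\<sigma>\<in>?\<Sigma>. \<Prod>a = 1..Suc k. delta G (x \<otimes> \<sigma> a \<otimes> y \<otimes> inv (\<sigma> a))) =
      (\<Sum>p\<in>?C \<times> ?C \<times> ?\<Sigma>. \<Prod>a = 1..Suc k.
        delta G (fst p \<otimes> snd (snd p) a \<otimes> fst (snd p) \<otimes> inv (snd (snd p) a)))"
    by (simp add: sum.cartesian_product split_beta)
  also have "\<dots> = real (card ?A)"
    using assms fin by (subst sum_prod_delta) (auto intro!: arg_cong[where f = card])
  also have "\<dots> = real (order G) * real (card ?B)"
    by (simp only: card of_nat_mult)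
  also have "real (card ?B) = (\<Sum>p\<in>?C \<times> ?T. \<Prod>a = 1..k.
        delta G (fst p \<otimes> snd p a \<otimes> inv (fst p) \<otimes> inv (snd p a)))"
    using assms fin by (subst sum_prod_delta) (auto intro!: arg_cong[where f = card])
  also have "\<dots> = (\<Sum>x\<in>?C. \<Sum>\<tau>\<in>?T. \<Prod>a = 1..k. delta G (x \<otimes> \<tau> a \<otimes> inv x \<otimes> inv (\<tau> a)))"
    by (simp add: sum.cartesian_product split_beta)
  finally show ?thesis .
qed

section \<open>Partition functions of products with the circle\<close>

text \<open>An edge of the product is a copy of an edge of \<open>\<Gamma>\<close> or the circle
  over a vertex, so a gauge field is a pair of an edge field \<open>g\<close> and a vertex field
  \<open>h\<close>. Flatness of the square over \<open>e\<close> says that \<open>g e\<close>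
  conjugates \<open>h\<close> at the head into \<open>h\<close> at the tail.\<close>

lemma partition_function_times_circle:
  fixes \<Gamma> :: "('v, 'e) pre_digraph"
  assumes "wf_digraph \<Gamma>"
  shows "partition_function (times_circle \<Gamma>) G =
    1 / real (order G) ^ card (verts \<Gamma>) *
    (\<Sum>h\<in>verts \<Gamma> \<rightarrow>\<^sub>E carrier G. \<Sum>g\<in>arcs \<Gamma> \<rightarrow>\<^sub>E carrier G. \<Prod>e\<in>arcs \<Gamma>.
      delta G (g e \<otimes> h (head \<Gamma> e) \<otimes> inv (g e) \<otimes> inv (h (tail \<Gamma> e))))"
proof -
  let ?V = "verts \<Gamma>" and ?E = "arcs \<Gamma>" and ?C = "carrier G"
  let ?A = "?E \<times> {()} <+> ?V \<times> {()}"
  \<comment> \<open>Well-formedness puts both ends of an edge into \<open>?V\<close>, where the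
    restricted vertex field of \<open>j\<close> agrees with the original field.\<close>
  note ends = wf_digraph.tail_in_verts[OF assms] wf_digraph.head_in_verts[OF assms]
  define i where "i = (\<lambda>(h, g :: 'e \<Rightarrow> 'a). \<lambda>a\<in>?A. case_sum (\<lambda>(e, _). g e) (\<lambda>(v, _). h v) a)"
  define j where "j = (\<lambda>f :: _ \<Rightarrow> 'a. (\<lambda>v\<in>?V. f (Inr (v, ())), \<lambda>e\<in>?E. f (Inl (e, ()))))"
  have "(\<Sum>f\<in>?A \<rightarrow>\<^sub>E ?C. \<Prod>(e, u)\<in>?E \<times> {()}.
      delta G (f (Inl (e, ())) \<otimes> f (Inr (head \<Gamma> e, ())) \<otimes> inv (f (Inl (e, ())))
        \<otimes> inv (f (Inr (tail \<Gamma> e, ()))))) =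
    (\<Sum>(h, g)\<in>(?V \<rightarrow>\<^sub>E ?C) \<times> (?E \<rightarrow>\<^sub>E ?C). \<Prod>e\<in>?E.
      delta G (g e \<otimes> h (head \<Gamma> e) \<otimes> inv (g e) \<otimes> inv (h (tail \<Gamma> e))))"
  proof (rule sum.reindex_bij_witness[where i = i and j = j])
    fix f assume f: "f \<in> ?A \<rightarrow>\<^sub>E ?C"
    show "j f \<in> (?V \<rightarrow>\<^sub>E ?C) \<times> (?E \<rightarrow>\<^sub>E ?C)"
      using f by (auto simp: j_def)
    show "i (j f) = f"
    proof
      fix a
      show "i (j f) a = f a"
        using f by (auto simp: i_def j_def PiE_arb[OF f] split: sum.split)
    qed
    have "(\<Prod>(e, u)\<in>?E \<times> {()}. F e) = (\<Prod>e\<in>?E. F e)" for F :: "_ \<Rightarrow> real"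
      by (simp flip: prod.cartesian_product)
    then show "(case j f of (h, g) \<Rightarrow> \<Prod>e\<in>?E.
        delta G (g e \<otimes> h (head \<Gamma> e) \<otimes> inv (g e) \<otimes> inv (h (tail \<Gamma> e)))) =
      (\<Prod>(e, u)\<in>?E \<times> {()}.
        delta G (f (Inl (e, ())) \<otimes> f (Inr (head \<Gamma> e, ())) \<otimes> inv (f (Inl (e, ())))
        \<otimes> inv (f (Inr (tail \<Gamma> e, ())))))"
      by (auto simp: j_def ends intro!: prod.cong)
  next
    fix p assume p: "p \<in> (?V \<rightarrow>\<^sub>E ?C) \<times> (?E \<rightarrow>\<^sub>E ?C)"
    show "i p \<in> ?A \<rightarrow>\<^sub>E ?C"
      using p by (auto simp: i_def)
    show "j (i p) = p"
      using p by (auto simp: i_def j_def fun_eq_iff PiE_iff extensional_def)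
  qed
  moreover have "holonomy G f (bdry (times_circle \<Gamma>) (e, u)) =
      f (Inl (e, ())) \<otimes> f (Inr (head \<Gamma> e, ())) \<otimes> inv (f (Inl (e, ())))
        \<otimes> inv (f (Inr (tail \<Gamma> e, ())))"
    if "f \<in> ?A \<rightarrow>\<^sub>E ?C" "e \<in> ?E" for f e u
  proof -
    \<comment> \<open>Membership in the carrier lets the group laws reassociate the right-nested
      holonomy and absorb its final unit.\<close>
    have "f (Inl (e, ())) \<in> ?C" "f (Inr (head \<Gamma> e, ())) \<in> ?C" "f (Inr (tail \<Gamma> e, ())) \<in> ?C"
      using that(2) by (auto simp: ends intro!: PiE_mem[OF that(1)])
    then show ?thesis
      by (simp add: times_circle_def graph_prod_def circle_def holonomy_def m_assoc)
  qed
  then have "(\<Sum>f\<in>?A \<rightarrow>\<^sub>E ?C. \<Prod>P\<in>?E \<times> {()}. delta G (holonomy G f (bdry (times_circle \<Gamma>) P))) =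
    (\<Sum>f\<in>?A \<rightarrow>\<^sub>E ?C. \<Prod>(e, u)\<in>?E \<times> {()}.
      delta G (f (Inl (e, ())) \<otimes> f (Inr (head \<Gamma> e, ())) \<otimes> inv (f (Inl (e, ())))
        \<otimes> inv (f (Inr (tail \<Gamma> e, ())))))"
    by (intro sum.cong prod.cong) auto
  ultimately show ?thesis
    by (simp add: partition_function_def sum.cartesian_product card_cartesian_product)
      (simp add: times_circle_def graph_prod_def circle_def card_cartesian_product)
qed

text \<open>Every edge runs from vertex 1 to vertex 2, so all squares share the two circle variables
  \<open>h 1\<close> and \<open>h 2\<close>. Cyclic rotation of the holonomy and inversion of
  \<open>h 1\<close> give the Burnside sum.\<close>

lemma partition_function_G_graph:
  "partition_function (times_circle (G_graph d)) G =
    1 / (real (order G))\<^sup>2 * (\<Sum>x\<in>carrier G. \<Sum>y\<in>carrier G. \<Sum>\<sigma>\<in>{1..d} \<rightarrow>\<^sub>E carrier G.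
      \<Prod>a = 1..d. delta G (x \<otimes> \<sigma> a \<otimes> y \<otimes> inv (\<sigma> a)))"
proof -
  have delta_eq: "delta G (s \<otimes> y \<otimes> inv s \<otimes> inv x) = delta G (inv x \<otimes> s \<otimes> y \<otimes> inv s)"
    if "x \<in> carrier G" "y \<in> carrier G" "s \<in> carrier G" for x y s
  proof -
    \<comment> \<open>In a group \<open>u \<otimes> v\<close> is the unit exactly when
      \<open>v \<otimes> u\<close> is, so the delta is invariant under cyclic rotation.\<close>
    have "s \<otimes> y \<otimes> inv s \<otimes> inv x = \<one> \<longleftrightarrow> inv x \<otimes> (s \<otimes> y \<otimes> inv s) = \<one>"
      using that by (metis inv_closed inv_comm m_closed)
    then show ?thesis
      using that by (simp add: delta_def m_assoc)
  qed
  have "partition_function (times_circle (G_graph d)) G =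
    1 / (real (order G))\<^sup>2 * (\<Sum>h\<in>{1, 2::nat} \<rightarrow>\<^sub>E carrier G. \<Sum>\<sigma>\<in>{1..d} \<rightarrow>\<^sub>E carrier G.
      \<Prod>a = 1..d. delta G (\<sigma> a \<otimes> h 2 \<otimes> inv (\<sigma> a) \<otimes> inv (h 1)))"
    using partition_function_times_circle[OF fin_digraph.axioms(1)[OF fin_digraph_G_graph]]
    by (simp add: G_graph_def power2_eq_square)
  also have "(\<Sum>h\<in>{1, 2::nat} \<rightarrow>\<^sub>E carrier G. \<Sum>\<sigma>\<in>{1..d} \<rightarrow>\<^sub>E carrier G.
      \<Prod>a = 1..d. delta G (\<sigma> a \<otimes> h 2 \<otimes> inv (\<sigma> a) \<otimes> inv (h 1))) =
    (\<Sum>x\<in>carrier G. \<Sum>y\<in>carrier G. \<Sum>\<sigma>\<in>{1..d} \<rightarrow>\<^sub>E carrier G.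
      \<Prod>a = 1..d. delta G (\<sigma> a \<otimes> y \<otimes> inv (\<sigma> a) \<otimes> inv x))"
    by (rule sum_PiE_doubleton) simp
  also have "\<dots> = (\<Sum>x\<in>carrier G. \<Sum>y\<in>carrier G. \<Sum>\<sigma>\<in>{1..d} \<rightarrow>\<^sub>E carrier G.
      \<Prod>a = 1..d. delta G (inv x \<otimes> \<sigma> a \<otimes> y \<otimes> inv (\<sigma> a)))"
    by (intro sum.cong prod.cong refl delta_eq) auto
  also have "\<dots> = (\<Sum>x\<in>carrier G. \<Sum>y\<in>carrier G. \<Sum>\<sigma>\<in>{1..d} \<rightarrow>\<^sub>E carrier G.
      \<Prod>a = 1..d. delta G (x \<otimes> \<sigma> a \<otimes> y \<otimes> inv (\<sigma> a)))"
    by (rule sum.reindex_bij_witness[where i = "m_inv G" and j = "m_inv G"]) auto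
  finally show ?thesis .
qed

text \<open>Both ends of a loop carry the same circle variable, so each holonomy is a commutator.
  The delta takes the same value on its inverse, which is the commutator in the opposite
  order.\<close>

lemma partition_function_F_graph:
  "partition_function (times_circle (F_graph k)) G =
    1 / real (order G) * (\<Sum>x\<in>carrier G. \<Sum>\<tau>\<in>{1..k} \<rightarrow>\<^sub>E carrier G.
      \<Prod>a = 1..k. delta G (x \<otimes> \<tau> a \<otimes> inv x \<otimes> inv (\<tau> a)))"
proof -
  have delta_eq: "delta G (t \<otimes> x \<otimes> inv t \<otimes> inv x) = delta G (x \<otimes> t \<otimes> inv x \<otimes> inv t)"
    if "x \<in> carrier G" "t \<in> carrier G" for x t
  proof -
    have "inv (t \<otimes> x \<otimes> inv t \<otimes> inv x) = x \<otimes> t \<otimes> inv x \<otimes> inv t"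
      using that by (simp add: inv_mult_group m_assoc)
    then show ?thesis
      using that unfolding delta_def by (metis inv_closed inv_eq_1_iff m_closed)
  qed
  have "partition_function (times_circle (F_graph k)) G =
    1 / real (order G) * (\<Sum>h\<in>{()} \<rightarrow>\<^sub>E carrier G. \<Sum>\<tau>\<in>{1..k} \<rightarrow>\<^sub>E carrier G.
      \<Prod>a = 1..k. delta G (\<tau> a \<otimes> h () \<otimes> inv (\<tau> a) \<otimes> inv (h ())))"
    using partition_function_times_circle[OF fin_digraph.axioms(1)[OF fin_digraph_F_graph]]
    by (simp add: F_graph_def)
  also have "(\<Sum>h\<in>{()} \<rightarrow>\<^sub>E carrier G. \<Sum>\<tau>\<in>{1..k} \<rightarrow>\<^sub>E carrier G.
      \<Prod>a = 1..k. delta G (\<tau> a \<otimes> h () \<otimes> inv (\<tau> a) \<otimes> inv (h ()))) =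
    (\<Sum>x\<in>carrier G. \<Sum>\<tau>\<in>{1..k} \<rightarrow>\<^sub>E carrier G.
      \<Prod>a = 1..k. delta G (\<tau> a \<otimes> x \<otimes> inv (\<tau> a) \<otimes> inv x))"
    by (rule sum_PiE_singleton)
  also have "\<dots> = (\<Sum>x\<in>carrier G. \<Sum>\<tau>\<in>{1..k} \<rightarrow>\<^sub>E carrier G.
      \<Prod>a = 1..k. delta G (x \<otimes> \<tau> a \<otimes> inv x \<otimes> inv (\<tau> a)))"
    by (intro sum.cong prod.cong refl delta_eq) auto
  finally show ?thesis .
qed

end

section \<open>Specialization to the symmetric group\<close>

lemma order_sym_group: "order (sym_group n) = fact n"
  by (simp add: order_def sym_group_def card_permutations)

text \<open>Right multiplication by \<open>y\<close> is the action of \<open>inv y\<close>, and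
  inversion permutes the group. The class of each tuple is therefore its orbit.\<close>

lemma tuple_classes_eq_orbits:
  "perm_tuples d n // tuple_rel d n =
    orbits (sym_group n \<times>\<times> sym_group n) ({1..d} \<rightarrow>\<^sub>E carrier (sym_group n))
      (two_sided_action (sym_group n) {1..d})"
proof -
  interpret group "sym_group n" by (rule sym_group_is_group)
  let ?G = "sym_group n"
  have "tuple_rel d n `` {\<sigma>} = orbit (?G \<times>\<times> ?G) (two_sided_action ?G {1..d}) \<sigma>"
    if \<sigma>: "\<sigma> \<in> {1..d} \<rightarrow>\<^sub>E carrier ?G" for \<sigma>
  proof (intro equalityI subsetI)
    fix \<rho> assume "\<rho> \<in> tuple_rel d n `` {\<sigma>}"
    then obtain x y where xy: "x \<in> carrier ?G" "y \<in> carrier ?G" "\<rho> \<in> {1..d} \<rightarrow>\<^sub>E carrier ?G"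
      "\<forall>a\<in>{1..d}. \<rho> a = x \<otimes>\<^bsub>?G\<^esub> \<sigma> a \<otimes>\<^bsub>?G\<^esub> y"
      by (auto simp: tuple_rel_def perm_tuples_def)
    have "\<rho> = two_sided_action ?G {1..d} (x, inv\<^bsub>?G\<^esub> y) \<sigma>"
    proof
      fix a
      show "\<rho> a = two_sided_action ?G {1..d} (x, inv\<^bsub>?G\<^esub> y) \<sigma> a"
        using xy \<sigma>
          by (auto simp: two_sided_action_def PiE_arb[OF xy(3)] simp del: sym_group_inv_equality)
    qed
    then show "\<rho> \<in> orbit (?G \<times>\<times> ?G) (two_sided_action ?G {1..d}) \<sigma>"
      using xy(1,2) inv_closed by (auto simp: orbit_def simp del: sym_group_inv_equality)
  next
    fix \<rho> assume "\<rho> \<in> orbit (?G \<times>\<times> ?G) (two_sided_action ?G {1..d}) \<sigma>"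
    then obtain x y where xy: "x \<in> carrier ?G" "y \<in> carrier ?G"
      "\<rho> = two_sided_action ?G {1..d} (x, y) \<sigma>"
      by (auto simp: orbit_def)
    then have "\<rho> \<in> {1..d} \<rightarrow>\<^sub>E carrier ?G"
      using \<sigma> two_sided_action_closed[of "(x, y)" \<sigma> "{1..d}"] by simp
    moreover have "\<forall>a\<in>{1..d}. \<rho> a = x \<otimes>\<^bsub>?G\<^esub> \<sigma> a \<otimes>\<^bsub>?G\<^esub> inv\<^bsub>?G\<^esub> y"
      using xy \<sigma> by (simp add: two_sided_action_def del: sym_group_inv_equality)
    ultimately show "\<rho> \<in> tuple_rel d n `` {\<sigma>}"
      using xy(1) inv_closed[OF xy(2)] \<sigma> unfolding tuple_rel_def perm_tuples_def by blast
  qed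
  then show ?thesis
    by (auto simp: quotient_def orbits_def perm_tuples_def)
qed

theorem mainTheorem4:
  fixes d n :: nat
  assumes "d \<ge> 2" and "n \<ge> 1"
  shows "real (num_tuple_classes d n) = partition_function (times_circle (G_graph d)) (sym_group n)
       \<and> real (num_tuple_classes d n) = partition_function (times_circle (F_graph (d - 1))) (sym_group n)
       \<and> real (num_tuple_classes d n) =
           1 / (fact n)\<^sup>2 *
           (\<Sum>\<gamma>\<^sub>1 \<in> carrier (sym_group n). \<Sum>\<gamma>\<^sub>2 \<in> carrier (sym_group n).
            \<Sum>\<sigma> \<in> {1..d} \<rightarrow>\<^sub>E carrier (sym_group n).
              \<Prod>a = 1..d. delta (sym_group n)
                (\<gamma>\<^sub>1 \<otimes>\<^bsub>sym_group n\<^esub> \<sigma> a \<otimes>\<^bsub>sym_group n\<^esub> \<gamma>\<^sub>2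
                  \<otimes>\<^bsub>sym_group n\<^esub> inv\<^bsub>sym_group n\<^esub> (\<sigma> a)))
       \<and> real (num_tuple_classes d n) =
           1 / fact n *
           (\<Sum>\<gamma> \<in> carrier (sym_group n).
            \<Sum>\<tau> \<in> {1..d - 1} \<rightarrow>\<^sub>E carrier (sym_group n).
              \<Prod>a = 1..d - 1. delta (sym_group n)
                (\<gamma> \<otimes>\<^bsub>sym_group n\<^esub> \<tau> a \<otimes>\<^bsub>sym_group n\<^esub> inv\<^bsub>sym_group n\<^esub> \<gamma>
                  \<otimes>\<^bsub>sym_group n\<^esub> inv\<^bsub>sym_group n\<^esub> (\<tau> a)))"
proof -
  interpret group "sym_group n" by (rule sym_group_is_group)
  have fin: "finite (carrier (sym_group n))"
    by (simp add: sym_group_def finite_permutations)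
  \<comment> \<open>The index \<open>d\<close> is the one whose permutation gets eliminated, leaving
    \<open>k = d - 1\<close> commuting conditions.\<close>
  obtain k where d: "d = Suc k"
    using assms by (cases d) auto
  note Z = card_orbits_two_sided[OF fin finite_atLeastAtMost[of 1 d],
      folded tuple_classes_eq_orbits num_tuple_classes_def]
  note gauge = sum_gauge_fixed[OF fin, of k, folded d]
  have "d - 1 = k" using d by simp
  moreover have "real (num_tuple_classes d n) = 1 / real (order (sym_group n)) *
      (\<Sum>x\<in>carrier (sym_group n). \<Sum>\<tau>\<in>{1..k} \<rightarrow>\<^sub>E carrier (sym_group n). \<Prod>a = 1..k.
        delta (sym_group n) (x \<otimes>\<^bsub>sym_group n\<^esub> \<tau> a \<otimes>\<^bsub>sym_group n\<^esub> inv\<^bsub>sym_group n\<^esub> x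
          \<otimes>\<^bsub>sym_group n\<^esub> inv\<^bsub>sym_group n\<^esub> (\<tau> a)))"
    \<comment> \<open>The free sum over the last permutation cancels one of the two factors
      \<open>fact n\<close> in the denominator.\<close>
    unfolding Z gauge order_sym_group by (simp add: power2_eq_square)
  ultimately show ?thesis
    using Z partition_function_G_graph[of d] partition_function_F_graph[of k]
    by (simp only: order_sym_group of_nat_fact)
qed

end
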